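(* Let $A \in \mathbb{R}^{m \times n}$, let $Q \subset \mathbb{R}^m$ be closed and convex such that the collection $\{Q,\mathcal{R}(A)\}$ is boundedly linearly regular, and let $C=\{x \in \mathbb{R}^n : Ax \in Q\}$. Then for every $R>0$ there exists $\gamma>0$ such that for all $x \in \mathbb{R}^n$ with $\|x\|_2\le R$, \[ \operatorname{dist}(x,C) \le \gamma \cdot \operatorname{dist}(Ax, Q). \]
   Context: $\mathcal{R}(A)$ denotes the range of $A$; $\operatorname{dist}$ denotes Euclidean distance to a set. A collection of closed convex sets $C_1,\dots,C_r\subset\mathbb{R}^m$ with nonempty intersection $D=\bigcap_i C_i$ is boundedly linearly regular if for every $R>0$ there is $\gamma>0$ such that $\operatorname{dist}(y,D)^2\le\gamma\sum_{i=1}^r\operatorname{dist}(y,C_i)^2$ for all $y$ with $\|y\|_2\le R$. (In particular bounded linear regularity of $\{Q,\mathcal{R}(A)\}$ includes $Q\cap\mathcal{R}(A)\neq\emptyset$.) *)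

theory Defs
  imports "HOL-Analysis.Analysis"
begin

text \<open>Bounded linear regularity of a finite collection of closed convex sets
  C_1,...,C_r (given as a list), following the paper: the intersection D is
  nonempty, and for every R > 0 there is gamma > 0 with
  dist(y,D)^2 <= gamma * sum_i dist(y,C_i)^2 for all y with norm y <= R.\<close>

definition boundedly_linearly_regular :: "('a::euclidean_space) set list \<Rightarrow> bool" where
  "boundedly_linearly_regular Cs \<longleftrightarrow>
     (\<forall>C\<in>set Cs. closed C \<and> convex C) \<and>
     (\<Inter>(set Cs)) \<noteq> {} \<and>
     (\<forall>R>0. \<exists>\<gamma>>0. \<forall>y. norm y \<le> R \<longrightarrow>
        (infdist y (\<Inter>(set Cs)))\<^sup>2 \<le> \<gamma> * (\<Sum>C\<leftarrow>Cs. (infdist y C)\<^sup>2))"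

end

theory Submission
  imports Defs
begin

text \<open>Since \<open>Ax\<close> lies in \<open>\<R>(A)\<close>, bounded linear regularity of \<open>{Q, \<R>(A)}\<close> bounds
  \<open>dist(Ax, Q \<inter> \<R>(A))\<close> by a multiple of \<open>dist(Ax, Q)\<close>. A nearest point \<open>Aw\<close> of
  \<open>Q \<inter> \<R>(A)\<close> is reached from \<open>Ax\<close> by moving \<open>x\<close> along a preimage of \<open>Aw - Ax\<close>,
  and a bounded right inverse of \<open>A\<close> on its range keeps that move of size
  \<open>O(\<parallel>Aw - Ax\<parallel>)\<close>; the endpoint lies in \<open>C\<close>.\<close>

lemma linear_bounded_right_inverse_on_range:
  fixes f :: "'a::euclidean_space \<Rightarrow> 'b::euclidean_space"
  assumes "linear f"
  obtains c where "c > 0" "\<And>v. \<exists>p. f p = f v \<and> norm p \<le> c * norm (f v)"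
proof -
  obtain g where g: "linear g" "\<forall>v\<in>range f. f (g v) = v"
    using linear_exists_right_inverse_on[OF assms, of UNIV] by auto
  obtain c where "c > 0" "\<And>x. norm (g x) \<le> c * norm x"
    using linear_bounded_pos[OF g(1)] by blast
  with g(2) show thesis
    by (intro that[of c]) (auto intro!: exI[of _ "g (f _)"])
qed

lemma infdist_preimage_le:
  fixes f :: "'a::euclidean_space \<Rightarrow> 'b::euclidean_space"
  assumes "linear f" and "closed S" and "S \<inter> range f \<noteq> {}"
  obtains c where "c > 0" "\<And>x. infdist x (f -` S) \<le> c * infdist (f x) (S \<inter> range f)"
proof -
  obtain c where c: "c > 0" "\<And>v. \<exists>p. f p = f v \<and> norm p \<le> c * norm (f v)"
    using linear_bounded_right_inverse_on_range[OF assms(1)] by blast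
  have "closed (range f)"
    by (rule closed_subspace[OF linear_subspace_image[OF assms(1) subspace_UNIV]])
  with assms(2) have "closed (S \<inter> range f)" by (rule closed_Int)
  have "infdist x (f -` S) \<le> c * infdist (f x) (S \<inter> range f)" for x
  proof -
    obtain z where z: "z \<in> S \<inter> range f" "infdist (f x) (S \<inter> range f) = dist (f x) z"
      using infdist_attains_inf[OF \<open>closed (S \<inter> range f)\<close> assms(3)] by blast
    then obtain w where w: "z = f w" "f w \<in> S" by auto
    obtain p where p: "f p = f (x - w)" "norm p \<le> c * norm (f (x - w))"
      using c(2) by blast
    have "f (x - p) = f w"
      using p(1) by (simp add: linear_diff[OF assms(1)])
    then have "x - p \<in> f -` S" using w(2) by simp
    then have "infdist x (f -` S) \<le> dist x (x - p)" by (rule infdist_le)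
    also have "\<dots> = norm p" by (simp add: dist_norm)
    also have "\<dots> \<le> c * dist (f x) z"
      using p(2) w(1) by (simp add: dist_norm linear_diff[OF assms(1)])
    finally show ?thesis using z(2) by simp
  qed
  with c(1) show thesis by (rule that)
qed

lemma boundedly_linearly_regular_pair_infdist_le:
  fixes S T :: "'a::euclidean_space set"
  assumes "boundedly_linearly_regular [S, T]" and "R > 0"
  obtains \<gamma> where "\<gamma> > 0"
    "\<And>y. y \<in> T \<Longrightarrow> norm y \<le> R \<Longrightarrow> infdist y (S \<inter> T) \<le> \<gamma> * infdist y S"
proof -
  obtain g where g: "g > 0" "\<And>y. norm y \<le> R \<Longrightarrow>
      (infdist y (S \<inter> T))\<^sup>2 \<le> g * ((infdist y S)\<^sup>2 + (infdist y T)\<^sup>2)"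
    using assms unfolding boundedly_linearly_regular_def by (auto simp: Int_commute)
  have "infdist y (S \<inter> T) \<le> sqrt g * infdist y S" if "y \<in> T" "norm y \<le> R" for y
  proof -
    have "(infdist y (S \<inter> T))\<^sup>2 \<le> (sqrt g * infdist y S)\<^sup>2"
      using g(2)[OF that(2)] that(1) g(1) by (simp add: power_mult_distrib)
    then show ?thesis
      by (rule power2_le_imp_le)
        (intro mult_nonneg_nonneg real_sqrt_ge_zero less_imp_le[OF g(1)] infdist_nonneg)
  qed
  with g(1) show thesis by (intro that[of "sqrt g"]) auto
qed

theorem lemma3p7:
  fixes A :: "real^'n^'m" and Q :: "(real^'m) set"
  assumes "closed Q" and "convex Q"
    and "boundedly_linearly_regular [Q, range (\<lambda>x. A *v x)]"
  shows "\<forall>R>0. \<exists>\<gamma>>0. \<forall>x::real^'n. norm x \<le> R \<longrightarrow>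
           infdist x {x. A *v x \<in> Q} \<le> \<gamma> * infdist (A *v x) Q"
proof (intro allI impI)
  fix R :: real assume "R > 0"
  have lin: "linear ((*v) A)" by (rule matrix_vector_mul_linear)
  obtain B where B: "B > 0" "\<And>x. norm (A *v x) \<le> B * norm x"
    using linear_bounded_pos[OF lin] by blast
  obtain \<gamma> where \<gamma>: "\<gamma> > 0" "\<And>y. y \<in> range ((*v) A) \<Longrightarrow> norm y \<le> B * R \<Longrightarrow>
      infdist y (Q \<inter> range ((*v) A)) \<le> \<gamma> * infdist y Q"
    using boundedly_linearly_regular_pair_infdist_le[OF assms(3) mult_pos_pos[OF B(1) \<open>R > 0\<close>]]
    by blast
  have "Q \<inter> range ((*v) A) \<noteq> {}"
    using assms(3) by (simp add: boundedly_linearly_regular_def)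
  then obtain c where c: "c > 0"
      "\<And>x. infdist x ((*v) A -` Q) \<le> c * infdist (A *v x) (Q \<inter> range ((*v) A))"
    using infdist_preimage_le[OF lin assms(1)] by blast
  have "infdist x {x. A *v x \<in> Q} \<le> c * \<gamma> * infdist (A *v x) Q" if "norm x \<le> R" for x
  proof -
    have "norm (A *v x) \<le> B * R"
      using B that by (meson mult_left_mono less_imp_le order_trans)
    then have "infdist (A *v x) (Q \<inter> range ((*v) A)) \<le> \<gamma> * infdist (A *v x) Q"
      by (intro \<gamma>(2)) auto
    then have "c * infdist (A *v x) (Q \<inter> range ((*v) A)) \<le> c * (\<gamma> * infdist (A *v x) Q)"
      using c(1) by simp
    then show ?thesis
      using c(2)[of x] by (simp add: vimage_def mult.assoc)
  qed
  with c(1) \<gamma>(1) show "\<exists>\<gamma>>0. \<forall>x::real^'n. norm x \<le> R \<longrightarrow>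
      infdist x {x. A *v x \<in> Q} \<le> \<gamma> * infdist (A *v x) Q"
    by (intro exI[of _ "c * \<gamma>"]) auto
qed

end
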